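(* Let $a_0^{[0]},a_0^{[1]},a_1^{[1]},a_0^{[2]},a_1^{[2]},a_0^{[3]}\in\mathbb C$ with $a_1^{[1]}\neq 0$ and $a_0^{[3]}\neq 0$, put $$a_0(x)=a_0^{[0]},\quad a_1(x)=a_0^{[1]}+a_1^{[1]}x,\quad a_2(x)=a_0^{[2]}+a_1^{[2]}x,\quad a_3(x)=a_0^{[3]},$$ $$J=a_0(x)I+a_1(x)D+\frac{a_2(x)}{2}D^2+\frac{a_3(x)}{3!}D^3,\qquad \lambda_n^{[0]}=n\,a_1^{[1]}+a_0^{[0]}\quad(n\ge 0),$$ and assume $\lambda_n^{[0]}\ne 0$ for all $n\ge 0$. (i) Let $\{P_n\}_{n\ge 0}$ be a monic $2$-orthogonal polynomial sequence with $J(P_n(x))=\lambda_n^{[0]}P_n(x)$ for all $n\ge 0$. Then $a_1^{[2]}=0$ and the recurrence coefficients of $\{P_n\}_{n\ge0}$ are $$\beta_n=-\frac{a_0^{[1]}}{a_1^{[1]}},\quad n\ge 0,$$ $$\alpha_{n+1}=-\frac{a_0^{[2]}}{2a_1^{[1]}}(n+1),\quad n\ge 0,$$ $$\gamma_{n+1}=-\frac{a_0^{[3]}}{a_1^{[1]}}\Big(\frac13+\frac12 n+\frac16 n^2\Big)=-\frac{a_0^{[3]}}{6a_1^{[1]}}(n+1)(n+2),\quad n\ge 0.$$ (ii) Conversely, if $a_1^{[2]}=0$ (so that $a_2(x)=a_0^{[2]}$), the $2$-orthogonal polynomial sequence $\{P_n\}_{n\ge0}$ defined by the recurrence coefficients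 in (i) satisfies $J(P_n(x))=\lambda_n^{[0]}P_n(x)$ for all $n\ge 0$.
   Context: $D=d/dx$ and $I$ is the identity on the space of complex polynomials. A monic polynomial sequence is a sequence $\{P_n\}_{n\ge0}$ of monic polynomials over $\mathbb C$ with $\deg P_n=n$; its dual sequence $\{u_n\}_{n\ge0}$ is the sequence of linear functionals on polynomials with $\langle u_n,P_m\rangle=\delta_{n,m}$. The sequence is $2$-orthogonal (with respect to $(u_0,u_1)$) if for $\nu=0,1$ and all $m\ge0$: $\langle u_\nu,P_mP_n\rangle=0$ for $n\ge 2m+\nu+1$, and $\langle u_\nu,P_mP_{2m+\nu}\rangle\ne0$. Equivalently (a known theorem), there are complex numbers $\{\beta_n\}_{n\ge0}$, $\{\alpha_n\}_{n\ge1}$, $\{\gamma_n\}_{n\ge1}$ (the recurrence coefficients) with $\gamma_n\neq0$ for all $n\ge1$ such that $P_0(x)=1$, $P_1(x)=x-\beta_0$, $P_2(x)=(x-\beta_1)P_1(x)-\alpha_1$ and $$P_{n+3}(x)=(x-\beta_{n+2})P_{n+2}(x)-\alpha_{n+2}P_{n+1}(x)-\gamma_{n+1}P_n(x),\quad n\ge0.$$ *)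

theory Defs
  imports Complex_Main "HOL-Computational_Algebra.Polynomial"
begin

definition monic_polynomial_sequence :: "(nat \<Rightarrow> complex poly) \<Rightarrow> bool" where
  "monic_polynomial_sequence P \<longleftrightarrow> (\<forall>n. degree (P n) = n \<and> lead_coeff (P n) = 1)"

abbreviation linear_functional :: "(complex poly \<Rightarrow> complex) \<Rightarrow> bool" where
  "linear_functional u \<equiv> Vector_Spaces.linear smult (*) u"

definition dual_sequence ::
    "(nat \<Rightarrow> complex poly) \<Rightarrow> (nat \<Rightarrow> complex poly \<Rightarrow> complex) \<Rightarrow> bool" where
  "dual_sequence P u \<longleftrightarrow>
     (\<forall>n. linear_functional (u n)) \<and> (\<forall>n m. u n (P m) = (if n = m then 1 else 0))"

text \<open>The dual sequence of a monic polynomial sequence exists and is unique, since the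
  sequence is a basis of the space of polynomials; the existential quantifier therefore refers
  to the dual sequence.\<close>

definition two_orthogonal :: "(nat \<Rightarrow> complex poly) \<Rightarrow> bool" where
  "two_orthogonal P \<longleftrightarrow> monic_polynomial_sequence P \<and>
     (\<exists>u. dual_sequence P u \<and>
       (\<forall>\<nu>\<in>{0, 1}. \<forall>m.
          (\<forall>n \<ge> 2 * m + \<nu> + 1. u \<nu> (P m * P n) = 0) \<and>
          u \<nu> (P m * P (2 * m + \<nu>)) \<noteq> 0))"

text \<open>The coefficient sequences \<open>\<alpha>\<close> and \<open>\<gamma>\<close> are indexed from 1; their values at 0 are
  never used.\<close>

fun recurrence_polys ::
    "(nat \<Rightarrow> complex) \<Rightarrow> (nat \<Rightarrow> complex) \<Rightarrow> (nat \<Rightarrow> complex) \<Rightarrow> nat \<Rightarrow> complex poly" where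
  "recurrence_polys \<beta> \<alpha> \<gamma> 0 = 1"
| "recurrence_polys \<beta> \<alpha> \<gamma> (Suc 0) = [:- \<beta> 0, 1:]"
| "recurrence_polys \<beta> \<alpha> \<gamma> (Suc (Suc 0)) =
     [:- \<beta> 1, 1:] * recurrence_polys \<beta> \<alpha> \<gamma> (Suc 0) - [:\<alpha> 1:]"
| "recurrence_polys \<beta> \<alpha> \<gamma> (Suc (Suc (Suc n))) =
     [:- \<beta> (n + 2), 1:] * recurrence_polys \<beta> \<alpha> \<gamma> (Suc (Suc n))
     - smult (\<alpha> (n + 2)) (recurrence_polys \<beta> \<alpha> \<gamma> (Suc n))
     - smult (\<gamma> (n + 1)) (recurrence_polys \<beta> \<alpha> \<gamma> n)"

definition recurrence_coefficients ::
    "(nat \<Rightarrow> complex poly) \<Rightarrow> (nat \<Rightarrow> complex) \<Rightarrow> (nat \<Rightarrow> complex) \<Rightarrow> (nat \<Rightarrow> complex) \<Rightarrow> bool" where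
  "recurrence_coefficients P \<beta> \<alpha> \<gamma> \<longleftrightarrow>
     (\<forall>n \<ge> 1. \<gamma> n \<noteq> 0) \<and> (\<forall>n. P n = recurrence_polys \<beta> \<alpha> \<gamma> n)"

definition third_order_operator ::
    "complex poly \<Rightarrow> complex poly \<Rightarrow> complex poly \<Rightarrow> complex poly \<Rightarrow> complex poly \<Rightarrow> complex poly" where
  "third_order_operator a0 a1 a2 a3 p =
     a0 * p + a1 * pderiv p + smult (1 / 2) a2 * (pderiv ^^ 2) p
     + smult (1 / fact 3) a3 * (pderiv ^^ 3) p"

end

theory Submission
  imports Defs
begin

text \<open>
  Let \<open>X\<close> be multiplication by \<open>x\<close>, which lowers the index of the \<open>P\<^sub>n\<close> by at most 2 because of
  2-orthogonality. The operator \<open>M = [J, X] - a\<^sub>1\<^sub>1 X\<close> satisfies \<open>[M, X] = a\<^sub>2 + a\<^sub>0\<^sub>3 D\<close>, and the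
  eigenvalue equation makes \<open>M\<close> lower the index by at most 2 as well. Since the contributions to
  the fourth diagonal cancel in \<open>[M, X]\<close>, \<open>D\<close> lowers the index by at most 3. Comparing
  coefficients in \<open>(J - \<lambda>\<^sub>n\<^sub>-\<^sub>1) P\<^sub>n' = - (a\<^sub>1\<^sub>2 / 2) P\<^sub>n''\<close> for \<open>n \<le> 6\<close>, a nonzero \<open>a\<^sub>1\<^sub>2\<close>
  would make the coefficient of \<open>P\<^sub>n\<^sub>-\<^sub>3\<close> in \<open>P\<^sub>n'\<close> nonzero for \<open>n = 3, 6\<close>, whereas the coefficient of
  \<open>P\<^sub>0\<close> in \<open>P\<^sub>6''\<close>, the product of these two, vanishes. Hence \<open>a\<^sub>1\<^sub>2 = 0\<close>.

  Conversely, the recurrence of (i) is solved by an Appell sequence, \<open>P\<^sub>n' = n P\<^sub>n\<^sub>-\<^sub>1\<close>, which turns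
  the recurrence into the eigenvalue equation. The eigenvalues are distinct, so monic
  eigenpolynomials are unique, and the recurrence coefficients in (i) follow from this case.
\<close>

section \<open>Dual sequences\<close>

lemma linear_functional_iff:
  "linear_functional u \<longleftrightarrow>
     (\<forall>p q. u (p + q) = u p + u q) \<and> (\<forall>c p. u (smult c p) = c * u p)"
proof -
  have 1: "vector_space (smult :: complex \<Rightarrow> _)"
    by unfold_locales (simp_all add: smult_add_right smult_add_left)
  have 2: "vector_space ((*) :: complex \<Rightarrow> _)"
    by unfold_locales (simp_all add: algebra_simps)
  show ?thesis
    unfolding Vector_Spaces.linear_iff using 1 2 by blast
qed

lemma linear_functional_sum:
  assumes "linear_functional f"
  shows "f (\<Sum>k\<in>A. smult (c k) (q k)) = (\<Sum>k\<in>A. c k * f (q k))"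
proof -
  have 0: "f 0 = 0"
    using assms unfolding linear_functional_iff by (metis mult_zero_left smult_0_left)
  have "f (sum g A) = (\<Sum>k\<in>A. f (g k))" for g
    using assms 0 unfolding linear_functional_iff
    by (induction A rule: infinite_finite_induct) auto
  then show ?thesis using assms by (simp add: linear_functional_iff)
qed

text \<open>The value of \<open>u\<^sub>n\<close> at \<open>x\<^sup>m\<close>, forced by \<open>u\<^sub>n (P\<^sub>m) = \<delta>\<^sub>n\<^sub>m\<close>.\<close>

fun dual_moment :: "(nat \<Rightarrow> complex poly) \<Rightarrow> nat \<Rightarrow> nat \<Rightarrow> complex" where
  "dual_moment P n m =
     (if n = m then 1 else 0) - (\<Sum>k<m. coeff (P m) k * dual_moment P n k)"

declare dual_moment.simps [simp del]

lemma sum_coeff_degree_le: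
  fixes w :: "nat \<Rightarrow> complex"
  assumes "degree p \<le> N"
  shows "(\<Sum>k\<le>degree p. coeff p k * w k) = (\<Sum>k\<le>N. coeff p k * w k)"
  by (rule sum.mono_neutral_left) (use assms in \<open>auto intro: le_degree\<close>)

text \<open>Summation up to \<open>degree p\<close> is not visibly additive; enlarging the range to
  a common degree bound makes it so. This is the functional with moments \<open>w\<close>.\<close>

lemma linear_functional_moments:
  "linear_functional (\<lambda>p. \<Sum>k\<le>degree p. coeff p k * w k)"
  unfolding linear_functional_iff
proof (intro conjI allI)
  fix p q :: "complex poly"
  define N where "N = max (degree p) (degree q)"
  have N: "degree p \<le> N" "degree q \<le> N" "degree (p + q) \<le> N"
    by (auto simp: N_def degree_add_le_max)
  show "(\<Sum>k\<le>degree (p + q). coeff (p + q) k * w k) =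
     (\<Sum>k\<le>degree p. coeff p k * w k) + (\<Sum>k\<le>degree q. coeff q k * w k)"
    unfolding N[THEN sum_coeff_degree_le] by (simp add: distrib_right sum.distrib)
next
  fix c and p :: "complex poly"
  show "(\<Sum>k\<le>degree (smult c p). coeff (smult c p) k * w k) =
     c * (\<Sum>k\<le>degree p. coeff p k * w k)"
    by (simp add: sum_coeff_degree_le[OF degree_smult_le] sum_distrib_left mult.assoc)
qed

text \<open>As \<open>P m\<close> has leading coefficient 1, the equation for its value under the
  \<open>n\<close>-th functional can be solved for the \<open>m\<close>-th moment, which is the
  recursion of \<open>dual_moment\<close>.\<close>

lemma dual_sequence_exists:
  assumes "monic_polynomial_sequence P"
  shows "\<exists>u. dual_sequence P u"
proof
  have deg: "degree (P m) = m" and lead: "coeff (P m) m = 1" for m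
    using assms unfolding monic_polynomial_sequence_def by metis+
  show "dual_sequence P (\<lambda>n p. \<Sum>k\<le>degree p. coeff p k * dual_moment P n k)"
    unfolding dual_sequence_def
  proof (intro conjI allI linear_functional_moments)
    fix n m
    have "(\<Sum>k\<le>m. coeff (P m) k * dual_moment P n k) =
      (\<Sum>k<m. coeff (P m) k * dual_moment P n k) + dual_moment P n m"
      by (simp add: lessThan_Suc_atMost[symmetric] lead)
    then show "(\<Sum>k\<le>degree (P m). coeff (P m) k * dual_moment P n k) = (if n = m then 1 else 0)"
      by (simp add: deg dual_moment.simps[of P n m])
  qed
qed

section \<open>Coordinates with respect to a monic polynomial sequence\<close>

locale monic_dual_basis =
  fixes P :: "nat \<Rightarrow> complex poly" and u :: "nat \<Rightarrow> complex poly \<Rightarrow> complex"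
  assumes monic: "monic_polynomial_sequence P"
    and dual: "dual_sequence P u"
begin

lemma degree_P [simp]: "degree (P n) = n"
  and coeff_P_same [simp]: "coeff (P n) n = 1"
  using monic unfolding monic_polynomial_sequence_def by metis+

lemma u_linear: "linear_functional (u k)"
  and u_P: "u k (P n) = (if k = n then 1 else 0)"
  using dual unfolding dual_sequence_def by auto

lemma u_add: "u k (p + q) = u k p + u k q"
  and u_smult: "u k (smult c p) = c * u k p"
  using u_linear unfolding linear_functional_iff by auto

lemma u_0: "u k 0 = 0"
  using u_smult[of k 0 0] by simp

lemma u_diff: "u k (p - q) = u k p - u k q"
  using u_add[of k p "smult (-1) q"] u_smult[of k "-1" q] by simp

lemma expansion_exists: "degree p \<le> N \<Longrightarrow> \<exists>c. p = (\<Sum>k\<le>N. smult (c k) (P k))"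
proof (induction N arbitrary: p)
  case 0
  then obtain a where "p = [:a:]" by (metis degree_eq_zeroE le_0_eq)
  moreover have "P 0 = [:1:]" by (metis coeff_P_same degree_P degree_eq_zeroE coeff_pCons_0)
  ultimately show ?case by (intro exI[of _ "\<lambda>_. a"]) simp
next
  case (Suc N)
  define q where "q = p - smult (coeff p (Suc N)) (P (Suc N))"
  have "degree q \<le> N"
  proof (rule degree_le, intro allI impI)
    fix i assume "N < i"
    then show "coeff q i = 0"
      using Suc.prems by (cases "i = Suc N") (auto simp: q_def coeff_eq_0)
  qed
  then obtain c where "q = (\<Sum>k\<le>N. smult (c k) (P k))" using Suc.IH by blast
  then have "p = (\<Sum>k\<le>Suc N. smult ((c(Suc N := coeff p (Suc N))) k) (P k))"
    by (simp add: q_def diff_eq_eq)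
  then show ?case by blast
qed

text \<open>Applying \<open>u j\<close> to any expansion isolates its \<open>j\<close>-th
  coefficient. Hence \<open>u k p\<close> is the \<open>k\<close>-th coordinate of \<open>p\<close>,
  and \<open>u k (T (P n))\<close> are the matrix entries of an operator \<open>T\<close>.\<close>

lemma expansion:
  assumes "degree p \<le> N"
  shows "p = (\<Sum>k\<le>N. smult (u k p) (P k))"
proof -
  obtain c where c: "p = (\<Sum>k\<le>N. smult (c k) (P k))" using expansion_exists[OF assms] by blast
  have "u j p = c j" if "j \<le> N" for j
    using that by (subst c) (simp add: linear_functional_sum[OF u_linear] u_P if_distrib cong: if_cong)
  then show ?thesis by (subst c) simp
qed

text \<open>With \<open>f q = u k (S q)\<close> and \<open>p = T (P n)\<close> this is the matrix
  product formula for operators \<open>S\<close> and \<open>T\<close>.\<close>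

lemma functional_expansion:
  assumes "linear_functional f" "degree p \<le> N"
  shows "f p = (\<Sum>k\<le>N. u k p * f (P k))"
  by (subst expansion[OF assms(2)]) (rule linear_functional_sum[OF assms(1)])

lemma u_eq_0: "degree p < k \<Longrightarrow> u k p = 0"
  by (subst functional_expansion[OF u_linear order.refl]) (auto simp: u_P intro!: sum.neutral)

lemma u_mult_linear: "linear_functional (\<lambda>p. u k (p * q))"
  by (simp add: linear_functional_iff u_add u_smult distrib_right)

lemma u_pCons_linear: "linear_functional (\<lambda>p. u k (pCons 0 p))"
  unfolding linear_functional_iff
proof (intro conjI allI)
  show "u k (pCons 0 (p + q)) = u k (pCons 0 p) + u k (pCons 0 q)" for p q
    by (simp flip: u_add)
  show "u k (pCons 0 (smult c p)) = c * u k (pCons 0 p)" for c p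
    by (simp flip: u_smult)
qed

lemma u_pderiv_linear: "linear_functional (\<lambda>p. u k (pderiv p))"
  by (simp add: linear_functional_iff pderiv_add pderiv_smult u_add u_smult)

end

section \<open>2-orthogonality and recurrences\<close>

locale two_orthogonal_basis = monic_dual_basis +
  assumes orth: "\<And>\<nu> m n. \<nu> \<in> {0, 1} \<Longrightarrow> 2 * m + \<nu> + 1 \<le> n \<Longrightarrow> u \<nu> (P m * P n) = 0"
    and nondeg: "\<And>\<nu> m. \<nu> \<in> {0, 1} \<Longrightarrow> u \<nu> (P m * P (2 * m + \<nu>)) \<noteq> 0"
begin

lemma orth_degree:
  assumes "\<nu> \<in> {0, 1}" "2 * degree q + \<nu> + 1 \<le> n"
  shows "u \<nu> (q * P n) = 0"
proof -
  have "u \<nu> (q * P n) = (\<Sum>k\<le>degree q. u k q * u \<nu> (P k * P n))"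
    by (rule functional_expansion[OF u_mult_linear order.refl])
  also have "\<dots> = 0" using assms by (auto intro!: sum.neutral orth)
  finally show ?thesis .
qed

text \<open>Strong induction on \<open>k = 2 * m + \<nu>\<close>: orthogonality kills
  \<open>u \<nu> (x * P m * P n)\<close>, as \<open>2 * (m + 1) + \<nu> < n\<close>. When
  \<open>x * P n\<close> is expanded instead, the terms below \<open>k\<close> vanish by induction
  and those above by orthogonality, so the \<open>k\<close>-th coordinate times a nonzero number is
  0.\<close>

lemma band:
  assumes "k + 2 < n"
  shows "u k (pCons 0 (P n)) = 0"
  using assms
proof (induction k rule: less_induct)
  case (less k)
  define m \<nu> where "m = k div 2" and "\<nu> = k mod 2"
  have k: "k = 2 * m + \<nu>" and \<nu>: "\<nu> \<in> {0, 1}" by (auto simp: m_def \<nu>_def)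
  have "degree (pCons 0 (P m)) \<le> Suc m" by (metis degree_pCons_le degree_P)
  then have "0 = u \<nu> (pCons 0 (P m) * P n)"
    using less.prems k by (intro orth_degree[OF \<nu>, symmetric]) auto
  also have "\<dots> = u \<nu> (pCons 0 (P n) * P m)" by (simp add: mult.commute)
  also have "\<dots> = (\<Sum>j\<le>Suc n. u j (pCons 0 (P n)) * u \<nu> (P j * P m))"
    using degree_pCons_le[of 0 "P n"] by (intro functional_expansion[OF u_mult_linear]) simp
  also have "\<dots> = (\<Sum>j\<in>{k}. u j (pCons 0 (P n)) * u \<nu> (P j * P m))"
  proof (rule sum.mono_neutral_right)
    show "{k} \<subseteq> {..Suc n}" using less.prems by simp
    show "\<forall>j\<in>{..Suc n} - {k}. u j (pCons 0 (P n)) * u \<nu> (P j * P m) = 0"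
    proof
      fix j assume "j \<in> {..Suc n} - {k}"
      then have "j \<noteq> k" by simp
      then consider "j < k" | "2 * m + \<nu> + 1 \<le> j" using k by arith
      then show "u j (pCons 0 (P n)) * u \<nu> (P j * P m) = 0"
        using less orth[OF \<nu>, of m j] by cases (auto simp: mult.commute)
    qed
  qed simp
  finally show ?case using nondeg[OF \<nu>, of m] k by (simp add: mult.commute)
qed

end

lemma two_orthogonal_basis_obtain:
  assumes "two_orthogonal P"
  obtains u where "two_orthogonal_basis P u"
  using assms unfolding two_orthogonal_def two_orthogonal_basis_def monic_dual_basis_def
    two_orthogonal_basis_axioms_def by blast


section \<open>Polynomials generated by the four-term recurrence\<close>

lemma recurrence_polys_degree_lead:
  "(\<forall>i>n. coeff (recurrence_polys \<beta> \<alpha> \<gamma> n) i = 0) \<and> coeff (recurrence_polys \<beta> \<alpha> \<gamma> n) n = 1"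
  by (induction \<beta> \<alpha> \<gamma> n rule: recurrence_polys.induct)
    (auto simp: coeff_pCons split: nat.splits)

lemma monic_recurrence_polys: "monic_polynomial_sequence (recurrence_polys \<beta> \<alpha> \<gamma>)"
  unfolding monic_polynomial_sequence_def
proof
  fix n
  have "degree (recurrence_polys \<beta> \<alpha> \<gamma> n) = n"
  proof (rule order.antisym)
    show "degree (recurrence_polys \<beta> \<alpha> \<gamma> n) \<le> n"
      using recurrence_polys_degree_lead[where n = n] by (intro degree_le) blast
    show "n \<le> degree (recurrence_polys \<beta> \<alpha> \<gamma> n)"
      using recurrence_polys_degree_lead[where n = n] by (intro le_degree) simp
  qed
  then show "degree (recurrence_polys \<beta> \<alpha> \<gamma> n) = n \<and> lead_coeff (recurrence_polys \<beta> \<alpha> \<gamma> n) = 1"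
    using recurrence_polys_degree_lead[where n = n] by simp
qed

lemma two_orthogonal_recurrence_polys:
  assumes \<gamma>: "\<And>n. \<gamma> (n + 1) \<noteq> 0"
  shows "two_orthogonal (recurrence_polys \<beta> \<alpha> \<gamma>)"
proof -
  define P where "P = recurrence_polys \<beta> \<alpha> \<gamma>"
  have monic: "monic_polynomial_sequence P" by (simp add: P_def monic_recurrence_polys)
  then obtain u where dual: "dual_sequence P u" using dual_sequence_exists by blast
  interpret monic_dual_basis P u using monic dual by unfold_locales
  have shift: "pCons 0 (P (k + 2)) = P (k + 3) + smult (\<beta> (k + 2)) (P (k + 2))
      + smult (\<alpha> (k + 2)) (P (k + 1)) + smult (\<gamma> (k + 1)) (P k)" for k
    by (simp add: P_def eval_nat_numeral)
  \<comment> \<open>Passing from \<open>P m\<close> to any \<open>q\<close> of degree at most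
    \<open>m\<close> makes induction possible: a factor \<open>x\<close> is split off from
    \<open>q\<close> and moved to \<open>P n\<close>, where the recurrence lowers the index by at
    most 2.\<close>
  have key: "(2 * m + \<nu> < n \<longrightarrow> u \<nu> (q * P n) = 0) \<and>
      (n = 2 * m + \<nu> \<and> coeff q m \<noteq> 0 \<longrightarrow> u \<nu> (q * P n) \<noteq> 0)"
    if "\<nu> \<le> 1" "degree q \<le> m" "2 * m + \<nu> \<le> n" for \<nu> m n q
    using that
  proof (induction m arbitrary: q n)
    case 0
    then obtain a where "q = [:a:]" by (metis degree_eq_zeroE le_0_eq)
    then show ?case by (simp add: u_smult u_P)
  next
    case (Suc m)
    obtain a q' where q: "q = pCons a q'" by (cases q)
    have q': "degree q' \<le> m" using Suc.prems by (simp add: q split: if_splits)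
    obtain k where n: "n = k + 2" and k: "2 * m + \<nu> \<le> k"
      using Suc.prems by (intro that[of "n - 2"]) auto
    have IH: "2 * m + \<nu> < i \<Longrightarrow> u \<nu> (q' * P i) = 0" for i
      using Suc.IH[OF Suc.prems(1) q', of i] by simp
    have "q * P n = smult a (P n) + q' * pCons 0 (P n)"
      by (simp add: q)
    then have "u \<nu> (q * P n) = a * u \<nu> (P n) + u \<nu> (q' * pCons 0 (P n))"
      by (simp only: u_add u_smult)
    also have "u \<nu> (P n) = 0" using Suc.prems by (simp add: u_P n)
    also have "u \<nu> (q' * pCons 0 (P n)) = u \<nu> (q' * P (k + 3)) + \<beta> (k + 2) * u \<nu> (q' * P (k + 2))
        + \<alpha> (k + 2) * u \<nu> (q' * P (k + 1)) + \<gamma> (k + 1) * u \<nu> (q' * P k)"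
      by (simp only: n shift distrib_left u_add mult_smult_right u_smult)
    \<comment> \<open>Only the lowest term can survive, since the other indices exceed
      \<open>2 * m + \<nu>\<close>. Nonvanishing for \<open>n = 2 * Suc m + \<nu>\<close> is thus
      inherited through the factor \<open>\<gamma> (k + 1)\<close>.\<close>
    also have "\<dots> = \<gamma> (k + 1) * u \<nu> (q' * P k)" using k by (simp add: IH)
    finally have "u \<nu> (q * P n) = \<gamma> (k + 1) * u \<nu> (q' * P k)" by simp
    moreover have "coeff q (Suc m) = coeff q' m" by (simp add: q)
    ultimately show ?case using Suc.IH[OF Suc.prems(1) q' k] \<gamma>[of k] by (auto simp: n)
  qed
  have "two_orthogonal P"
    unfolding two_orthogonal_def
  proof (intro conjI exI[of _ u] ballI allI impI monic dual)
    fix \<nu> m n :: nat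
    assume \<nu>: "\<nu> \<in> {0, 1}"
    show "u \<nu> (P m * P n) = 0" if "2 * m + \<nu> + 1 \<le> n"
      using key[of \<nu> "P m" m n] that \<nu> by auto
    show "u \<nu> (P m * P (2 * m + \<nu>)) \<noteq> 0"
      using key[of \<nu> "P m" m "2 * m + \<nu>"] \<nu> by auto
  qed
  then show ?thesis by (simp add: P_def)
qed

lemma monic_combination_eq_0:
  assumes P: "monic_polynomial_sequence P"
    and eq: "smult a (P (n + 2)) + smult b (P (n + 1)) + smult c (P n) = 0"
  shows "a = 0 \<and> b = 0 \<and> c = 0"
proof -
  have deg: "degree (P m) = m" and lead: "coeff (P m) m = 1" for m
    using P unfolding monic_polynomial_sequence_def by metis+
  have c: "a * coeff (P (n + 2)) i + b * coeff (P (n + 1)) i + c * coeff (P n) i = 0" for i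
    using arg_cong[OF eq, of "\<lambda>p. coeff p i"] by simp
  have "a = 0" using c[of "n + 2"] lead[of "n + 2"] by (simp add: coeff_eq_0 deg)
  moreover have "b = 0" using c[of "n + 1"] lead[of "n + 1"] \<open>a = 0\<close> by (simp add: coeff_eq_0 deg)
  moreover have "c = 0" using c[of n] lead[of n] \<open>a = 0\<close> \<open>b = 0\<close> by simp
  ultimately show ?thesis by simp
qed

text \<open>Two recurrences for the same polynomials differ by a vanishing combination of three
  consecutive members, which are linearly independent by degree.\<close>

lemma recurrence_polys_inject:
  assumes "recurrence_polys \<beta> \<alpha> \<gamma> = recurrence_polys \<beta>' \<alpha>' \<gamma>'"
  shows "\<beta> n = \<beta>' n \<and> \<alpha> (n + 1) = \<alpha>' (n + 1) \<and> \<gamma> (n + 1) = \<gamma>' (n + 1)"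
proof -
  define P where "P = recurrence_polys \<beta> \<alpha> \<gamma>"
  have monic: "monic_polynomial_sequence P" by (simp add: P_def monic_recurrence_polys)
  have P': "P = recurrence_polys \<beta>' \<alpha>' \<gamma>'" using assms by (simp add: P_def)
  have step: "\<beta> (k + 2) = \<beta>' (k + 2) \<and> \<alpha> (k + 2) = \<alpha>' (k + 2) \<and> \<gamma> (k + 1) = \<gamma>' (k + 1)" for k
  proof -
    have "P (k + 3) = [:- \<beta> (k + 2), 1:] * P (k + 2) - smult (\<alpha> (k + 2)) (P (k + 1))
        - smult (\<gamma> (k + 1)) (P k)"
      by (simp add: P_def eval_nat_numeral)
    moreover have "P (k + 3) = [:- \<beta>' (k + 2), 1:] * P (k + 2) - smult (\<alpha>' (k + 2)) (P (k + 1))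
        - smult (\<gamma>' (k + 1)) (P k)"
      by (simp add: P' eval_nat_numeral)
    ultimately have "smult (\<beta> (k + 2) - \<beta>' (k + 2)) (P (k + 2))
        + smult (\<alpha> (k + 2) - \<alpha>' (k + 2)) (P (k + 1)) + smult (\<gamma> (k + 1) - \<gamma>' (k + 1)) (P k) = 0"
      by (simp add: smult_diff_left algebra_simps)
    from monic_combination_eq_0[OF monic this] show ?thesis by simp
  qed
  have "P 1 = [:- \<beta> 0, 1:]" "P 1 = [:- \<beta>' 0, 1:]" by (simp add: P_def, simp add: P')
  then have 0: "\<beta> 0 = \<beta>' 0" by simp
  have "P 2 = [:- \<beta> 1, 1:] * P 1 - [:\<alpha> 1:]" "P 2 = [:- \<beta>' 1, 1:] * P 1 - [:\<alpha>' 1:]"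
    by (simp add: P_def eval_nat_numeral, simp add: P' eval_nat_numeral)
  with \<open>P 1 = [:- \<beta> 0, 1:]\<close> have 1: "\<beta> 1 = \<beta>' 1 \<and> \<alpha> 1 = \<alpha>' 1" by auto
  \<comment> \<open>For large \<open>n\<close> the three equalities come from three instances:
    \<open>\<gamma> (n + 1)\<close> from \<open>n\<close>, \<open>\<alpha> (n + 1)\<close> from
    \<open>n - 1\<close> and \<open>\<beta> n\<close> from \<open>n - 2\<close>. The initial
    polynomials supply the remaining values.\<close>
  show ?thesis
    using 0 1 step[of n] step[of "n - 1"] step[of "n - 2"]
    by (cases n; cases "n - 1") (auto simp: eval_nat_numeral)
qed

section \<open>The third order operator\<close>

text \<open>The matrix in the monomial basis: upper triangular with the eigenvalues on the diagonal.
  Operator identities below reduce to comparing these coefficients.\<close>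

lemma coeff_third_order_operator:
  "coeff (third_order_operator [:a00:] [:a01, a11:] [:a02, a12:] [:a03:] p) m =
     (a00 + of_nat m * a11) * coeff p m
     + (a01 * of_nat (m + 1) + a12 / 2 * of_nat m * of_nat (m + 1)) * coeff p (m + 1)
     + a02 / 2 * of_nat (m + 1) * of_nat (m + 2) * coeff p (m + 2)
     + a03 / 6 * of_nat (m + 1) * of_nat (m + 2) * of_nat (m + 3) * coeff p (m + 3)"
  by (cases m) (simp_all add: third_order_operator_def numeral_2_eq_2 numeral_3_eq_3
     coeff_pderiv field_simps)

locale third_order =
  fixes a00 a01 a11 a02 a12 a03 :: complex and J
  assumes J_def: "J = third_order_operator [:a00:] [:a01, a11:] [:a02, a12:] [:a03:]"
begin

abbreviation ev :: "nat \<Rightarrow> complex" where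
  "ev n \<equiv> a00 + of_nat n * a11"

lemma coeff_J:
  "coeff (J p) m = ev m * coeff p m
     + (a01 * of_nat (m + 1) + a12 / 2 * of_nat m * of_nat (m + 1)) * coeff p (m + 1)
     + a02 / 2 * of_nat (m + 1) * of_nat (m + 2) * coeff p (m + 2)
     + a03 / 6 * of_nat (m + 1) * of_nat (m + 2) * of_nat (m + 3) * coeff p (m + 3)"
  unfolding J_def by (rule coeff_third_order_operator)

lemma J_add: "J (p + q) = J p + J q"
  and J_diff: "J (p - q) = J p - J q"
  and J_smult: "J (smult c p) = smult c (J p)"
  by (rule poly_eqI, simp add: coeff_J field_simps)+

lemma degree_J_le: "degree (J p) \<le> degree p"
  by (rule degree_le) (auto simp: coeff_J coeff_eq_0)

text \<open>The commutator of \<open>D\<close> and \<open>J\<close> differentiates the coefficients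
  of \<open>J\<close>; only the slopes of the two linear ones remain.\<close>

lemma pderiv_J:
  "pderiv (J p) = J (pderiv p) + smult a11 (pderiv p) + smult (a12 / 2) (pderiv (pderiv p))"
  by (rule poly_eqI) (simp add: coeff_J coeff_pderiv field_simps eval_nat_numeral)

text \<open>Explicitly, \<open>M p\<close> is
  \<open>a01 * p + (a02 + a12 * x) * p' + (a03 / 2) * p''\<close>; the form by commutators is the
  one whose matrix entries are accessible.\<close>

definition M :: "complex poly \<Rightarrow> complex poly" where
  "M p = J (pCons 0 p) - pCons 0 (J p) - smult a11 (pCons 0 p)"

text \<open>Commuting with multiplication by \<open>x\<close> acts as formal differentiation with
  respect to \<open>D\<close>.\<close>

lemma M_commutator:
  "M (pCons 0 p) - pCons 0 (M p) = smult a02 p + smult a12 (pCons 0 p) + smult a03 (pderiv p)"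
proof (rule poly_eqI)
  fix m
  show "coeff (M (pCons 0 p) - pCons 0 (M p)) m =
    coeff (smult a02 p + smult a12 (pCons 0 p) + smult a03 (pderiv p)) m"
    by (cases m; cases "m - 1")
      (simp_all add: M_def coeff_J coeff_pCons coeff_pderiv eval_nat_numeral,
       simp_all add: field_simps)
qed

lemma M_add: "M (p + q) = M p + M q"
proof -
  have "pCons 0 (p + q) = pCons 0 p + pCons 0 q" for p q :: "complex poly" by simp
  then show ?thesis by (simp only: M_def J_add smult_add_right) (simp only: algebra_simps)
qed

lemma M_smult: "M (smult c p) = smult c (M p)"
proof -
  have "pCons 0 (smult c p) = smult c (pCons 0 p)" for c :: complex and p by simp
  then show ?thesis
    by (simp only: M_def J_smult smult_diff_right smult_smult mult.commute[of c])
qed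

text \<open>The bound agrees with that for multiplication by \<open>x\<close>, so both products in
  the commutator are sums over the same range.\<close>

lemma degree_M_le: "degree (M p) \<le> Suc (degree p)"
proof -
  have "degree (J (pCons 0 p)) \<le> Suc (degree p)"
    using degree_J_le degree_pCons_le le_trans by blast
  moreover have "degree (pCons 0 (J p)) \<le> Suc (degree p)"
    using degree_J_le[of p] degree_pCons_le[of 0 "J p"] by linarith
  moreover have "degree (smult a11 (pCons 0 p)) \<le> Suc (degree p)"
    using degree_smult_le degree_pCons_le le_trans by blast
  ultimately show ?thesis unfolding M_def by (intro degree_diff_le)
qed

text \<open>A nonzero difference would be an eigenvector for \<open>ev n\<close>. Its leading
  coefficient forces its degree to be \<open>n\<close>, because the eigenvalues are distinct, yet
  the leading terms cancel.\<close>

lemma eigenpolynomial_unique: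
  assumes "a11 \<noteq> 0"
    and p: "J p = smult (ev n) p" "degree p = n" "lead_coeff p = 1"
    and q: "J q = smult (ev n) q" "degree q = n" "lead_coeff q = 1"
  shows "p = q"
proof (rule ccontr)
  assume "p \<noteq> q"
  define r where "r = p - q"
  have r: "r \<noteq> 0" using \<open>p \<noteq> q\<close> by (simp add: r_def)
  have "J r = smult (ev n) r"
    by (simp only: r_def J_diff p(1) q(1) smult_diff_right)
  moreover have "coeff (J r) (degree r) = ev (degree r) * lead_coeff r"
    by (simp add: coeff_J coeff_eq_0)
  ultimately have "ev (degree r) * lead_coeff r = ev n * lead_coeff r"
    by (metis coeff_smult)
  then have "degree r = n" using r \<open>a11 \<noteq> 0\<close> by auto
  then have "lead_coeff r = 0" using p q by (simp add: r_def)
  then show False using r by simp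
qed

end

section \<open>Differentiation in the eigenbasis and the vanishing of \<open>a12\<close>\<close>

locale two_orthogonal_eigenbasis = third_order + two_orthogonal_basis +
  assumes a11: "a11 \<noteq> 0" and a03: "a03 \<noteq> 0"
    and eigen: "\<And>n. J (P n) = smult (ev n) (P n)"
begin

text \<open>\<open>J\<close> is diagonal in the basis \<open>P\<close>, so the dual functionals are
  its left eigenvectors.\<close>

lemma u_J: "u k (J p) = ev k * u k p"
proof -
  have "linear_functional (\<lambda>p. u k (J p))"
    by (simp add: linear_functional_iff J_add J_smult u_add u_smult)
  then have "u k (J p) = (\<Sum>j\<le>degree p. u j p * u k (J (P j)))"
    by (rule functional_expansion) simp
  also have "\<dots> = ev k * (\<Sum>j\<le>degree p. u j p * u k (P j))"
    unfolding sum_distrib_left by (rule sum.cong) (auto simp: eigen u_smult u_P)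
  also have "\<dots> = ev k * u k p"
    by (simp only: functional_expansion[OF u_linear order.refl, symmetric])
  finally show ?thesis .
qed

text \<open>The factor is \<open>ev k - ev n - a11\<close>; hence \<open>M\<close> inherits the band
  of multiplication by \<open>x\<close>.\<close>

lemma u_M_P: "u k (M (P n)) = (of_nat k - of_nat n - 1) * a11 * u k (pCons 0 (P n))"
proof -
  have "pCons 0 (smult c p) = smult c (pCons 0 p)" for c :: complex and p by simp
  then show ?thesis
    by (simp only: M_def u_diff u_J eigen u_smult) (simp only: algebra_simps mult_1)
qed

lemma u_pderiv_P_low:
  assumes "k + 3 < n"
  shows "u k (pderiv (P n)) = 0"
proof -
  let ?X = "\<lambda>k n. u k (pCons 0 (P n))"
  have "linear_functional (\<lambda>p. u k (M p))"
    by (simp add: linear_functional_iff M_add M_smult u_add u_smult)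
  then have 1: "u k (M (pCons 0 (P n))) = (\<Sum>j\<le>Suc n. ?X j n * u k (M (P j)))"
    using degree_pCons_le[of 0 "P n"] by (intro functional_expansion) auto
  have 2: "u k (pCons 0 (M (P n))) = (\<Sum>j\<le>Suc n. u j (M (P n)) * ?X k j)"
    using degree_M_le[of "P n"] by (intro functional_expansion[OF u_pCons_linear]) auto
  \<comment> \<open>Both factors can be nonzero only if \<open>j \<ge> n - 2\<close> and
    \<open>k \<ge> j - 2\<close>, which leaves \<open>j = n - 2\<close> and
    \<open>k = n - 4\<close>. There both entries of \<open>M\<close> carry the factor
    \<open>-3 * a11\<close>, and the products cancel.\<close>
  have "?X j n * u k (M (P j)) - u j (M (P n)) * ?X k j = 0" for j
  proof (cases "j + 2 = n \<and> k + 2 = j")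
    case True
    then show ?thesis by (auto simp: u_M_P algebra_simps)
  next
    case False
    then have "j + 2 < n \<or> k + 2 < j" using assms by arith
    then show ?thesis by (auto simp: u_M_P band)
  qed
  then have "u k (M (pCons 0 (P n)) - pCons 0 (M (P n))) = 0"
    unfolding u_diff 1 2 sum_subtractf[symmetric] by simp
  then have "a02 * u k (P n) + a12 * ?X k n + a03 * u k (pderiv (P n)) = 0"
    unfolding M_commutator u_add u_smult .
  then show ?thesis using assms a03 by (simp add: u_P band)
qed

lemma u_pderiv_P_high: "n \<le> k \<Longrightarrow> u k (pderiv (P n)) = 0"
  using pderiv_eq_0_iff[of "P n"] by (cases n) (auto simp: u_0 u_eq_0 degree_pderiv)

lemma u_pderiv_P_Suc: "u n (pderiv (P (Suc n))) = of_nat (Suc n)"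
proof -
  have "pderiv (P (Suc n)) = (\<Sum>k\<le>n. smult (u k (pderiv (P (Suc n)))) (P k))"
    by (rule expansion) (simp add: degree_pderiv)
  then have "coeff (pderiv (P (Suc n))) n =
      (\<Sum>k\<le>n. u k (pderiv (P (Suc n))) * coeff (P k) n)"
    by (metis (no_types, lifting) coeff_smult coeff_sum sum.cong)
  also have "\<dots> = (\<Sum>k\<in>{n}. u k (pderiv (P (Suc n))) * coeff (P k) n)"
    by (rule sum.mono_neutral_right) (auto simp: coeff_eq_0)
  finally show ?thesis by (simp add: coeff_pderiv)
qed

text \<open>\<open>pderiv_J\<close> is applied to \<open>P n\<close> and read in coordinates; the
  sum is an entry of the square of the matrix of \<open>D\<close>.\<close>

lemma u_pderiv_eigen:
  "(of_nat n - of_nat k - 1) * a11 * u k (pderiv (P n)) =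
     a12 / 2 * (\<Sum>j\<le>n. u j (pderiv (P n)) * u k (pderiv (P j)))"
proof -
  have "u k (pderiv (J (P n))) = ev k * u k (pderiv (P n)) + a11 * u k (pderiv (P n))
      + a12 / 2 * u k (pderiv (pderiv (P n)))"
    unfolding pderiv_J u_add u_smult u_J ..
  moreover have "u k (pderiv (J (P n))) = ev n * u k (pderiv (P n))"
    by (simp only: eigen pderiv_smult u_smult)
  moreover have "u k (pderiv (pderiv (P n))) =
      (\<Sum>j\<le>n. u j (pderiv (P n)) * u k (pderiv (P j)))"
    by (rule functional_expansion[OF u_pderiv_linear]) (simp add: degree_pderiv)
  ultimately show ?thesis by (simp add: algebra_simps)
qed

lemma a12_eq_0: "a12 = 0"
proof (rule ccontr)
  assume a12: "a12 \<noteq> 0"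
  define d where "d k n = u k (pderiv (P n))" for k n
  have high: "d k n = 0" if "n \<le> k" for k n using u_pderiv_P_high[OF that] by (simp add: d_def)
  have low: "d k n = 0" if "k + 3 < n" for k n using u_pderiv_P_low[OF that] by (simp add: d_def)
  have top: "d n (Suc n) = of_nat (Suc n)" for n using u_pderiv_P_Suc by (simp add: d_def)
  have top': "d 0 (Suc 0) = 1" "d (Suc 0) 2 = 2" "d 2 3 = 3" "d 3 4 = 4" "d 4 5 = 5" "d 5 6 = 6"
    using top[of 0] top[of 1] top[of 2] top[of 3] top[of 4] top[of 5]
    by (simp_all add: eval_nat_numeral)
  have eq: "(of_nat n - of_nat k - 1) * a11 * d k n = a12 / 2 * (\<Sum>j\<le>n. d j n * d k j)" for k n
    using u_pderiv_eigen by (simp add: d_def)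
  have sets: "{..2} = {0,1,2::nat}" "{..3} = {0,1,2,3::nat}" "{..5} = {0,1,2,3,4,5::nat}"
    "{..6} = {0,1,2,3,4,5,6::nat}" by auto
  \<comment> \<open>For \<open>k = n - 2\<close> only \<open>j = n - 1\<close> contributes, so the
    entry is \<open>n * (n - 1) / 2 * (a12 / a11)\<close>. The entries with \<open>k = n - 3\<close>
    then follow as nonzero multiples of the square of \<open>a12 / a11\<close>.\<close>
  have "d 0 2 = a12 / a11"
    using eq[of 2 0] a11 by (simp add: sets high low top' field_simps)
  moreover have "d 1 3 = 3 * (a12 / a11)"
    using eq[of 3 1] a11 by (simp add: sets high low top' field_simps)
  ultimately have d03: "d 0 3 \<noteq> 0"
    using eq[of 3 0] a11 a12 by (auto simp: sets high low top' field_simps)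
  have d35: "d 3 5 = 10 * (a12 / a11)"
    using eq[of 5 3] a11 by (simp add: sets high low top' field_simps)
  have d46: "d 4 6 = 15 * (a12 / a11)"
    using eq[of 6 4] a11 by (simp add: sets high low top' field_simps)
  have d36: "d 3 6 \<noteq> 0"
    using eq[of 6 3] a11 a12 by (auto simp: sets high low top' d35 d46)
  show False
    \<comment> \<open>The left side vanishes since \<open>d 0 6 = 0\<close>; on the right,
      \<open>D\<close> lowers the index by at most 3, so 6 reaches 0 in two steps only through
      3.\<close>
    using eq[of 6 0] d03 d36 a12 by (simp add: sets high low top')
qed

end

section \<open>The Appell sequence solving the recurrence\<close>

context
  fixes \<beta> \<alpha> \<gamma> :: "nat \<Rightarrow> complex" and b A C :: complex
  assumes \<beta>: "\<And>n. \<beta> n = b"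
    and \<alpha>: "\<And>n. \<alpha> (n + 1) = A * of_nat (n + 1)"
    and \<gamma>: "\<And>n. \<gamma> (n + 1) = C * of_nat (n + 1) * of_nat (n + 2)"
begin

text \<open>The linear growth of \<open>\<alpha>\<close> and the quadratic growth of
  \<open>\<gamma>\<close> are what lets the differentiated recurrence reproduce the recurrence one
  index lower.\<close>

lemma pderiv_recurrence_polys:
  "pderiv (recurrence_polys \<beta> \<alpha> \<gamma> (Suc n)) = smult (of_nat (Suc n)) (recurrence_polys \<beta> \<alpha> \<gamma> n)"
proof (induction n rule: less_induct)
  case (less n)
  define R where "R = recurrence_polys \<beta> \<alpha> \<gamma>"
  have R0: "R 0 = 1" and R1: "R (Suc 0) = [:-b, 1:]"
    and R2: "R (Suc (Suc 0)) = [:-b, 1:] * R (Suc 0) - [:A:]"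
    using \<alpha>[of 0] by (simp_all add: R_def eval_nat_numeral \<beta>)
  have R3: "R (k + 3) = [:-b, 1:] * R (k + 2) - smult (A * of_nat (k + 2)) (R (k + 1))
      - smult (C * of_nat (k + 1) * of_nat (k + 2)) (R k)" for k
    using \<alpha>[of "k + 1"] \<gamma>[of k] by (simp add: R_def eval_nat_numeral \<beta>)
  have IH: "pderiv (R (k + 1)) = smult (of_nat (k + 1)) (R k)" if "k < n" for k
    using less.IH[OF that] by (simp add: R_def)
  consider "n = 0" | "n = 1" | "n = 2" | k where "n = k + 3"
    by atomize_elim presburger
  then have "pderiv (R (n + 1)) = smult (of_nat (n + 1)) (R n)"
  proof cases
    case 1
    then show ?thesis by (simp add: R0 R1 pderiv_pCons)
  next
    case 2
    then show ?thesis by (simp add: R2 R1 pderiv_pCons)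
  next
    case 3
    then show ?thesis
      using R3[of 0] by (simp add: R0 R2 R1 numeral_2_eq_2 numeral_3_eq_3 pderiv_pCons pderiv_add
        pderiv_diff pderiv_smult algebra_simps)
  next
    case (4 k)
    have "pderiv (R (k + 4)) = R (k + 3) + [:-b, 1:] * pderiv (R (k + 3))
        - smult (A * of_nat (k + 3)) (pderiv (R (k + 2)))
        - smult (C * of_nat (k + 2) * of_nat (k + 3)) (pderiv (R (k + 1)))"
      using R3[of "k + 1"]
      by (simp add: pderiv_diff pderiv_add pderiv_smult pderiv_mult pderiv_pCons eval_nat_numeral)
    also have "\<dots> = R (k + 3) + [:-b, 1:] * smult (of_nat (k + 3)) (R (k + 2))
        - smult (A * of_nat (k + 3)) (smult (of_nat (k + 2)) (R (k + 1)))
        - smult (C * of_nat (k + 2) * of_nat (k + 3)) (smult (of_nat (k + 1)) (R k))"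
      using IH[of "k + 2"] IH[of "k + 1"] IH[of k] 4 by (simp add: eval_nat_numeral)
    \<comment> \<open>With the common factor \<open>k + 3\<close> taken out, the remaining three
      terms are the recurrence for \<open>R (k + 3)\<close>.\<close>
    also have "\<dots> = R (k + 3) + smult (of_nat (k + 3)) (R (k + 3))"
      unfolding R3[of k] poly_eq_poly_eq_iff[symmetric] by (rule ext) (simp add: algebra_simps)
    also have "\<dots> = smult (1 + of_nat (k + 3)) (R (k + 3))"
      by (simp only: smult_add_left smult_1_left)
    also have "1 + of_nat (k + 3) = (of_nat (k + 4) :: complex)" by simp
    finally show ?thesis by (simp add: 4 eval_nat_numeral)
  qed
  then show ?case by (simp add: R_def)
qed

text \<open>By the Appell property, the derivative terms amount to \<open>n * a11\<close> times the
  right side of the recurrence for the \<open>n\<close>-th polynomial. The coefficients are the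
  formulas of (i) solved for \<open>a01\<close>, \<open>a02\<close> and \<open>a03\<close>.\<close>

lemma eigen_recurrence_polys:
  "third_order_operator [:a00:] [:- a11 * b, a11:] [:- 2 * a11 * A:] [:- 6 * a11 * C:]
      (recurrence_polys \<beta> \<alpha> \<gamma> n) =
     smult (a00 + of_nat n * a11) (recurrence_polys \<beta> \<alpha> \<gamma> n)"
proof -
  define R where "R = recurrence_polys \<beta> \<alpha> \<gamma>"
  have d: "pderiv (R (Suc k)) = smult (of_nat (Suc k)) (R k)" for k
    using pderiv_recurrence_polys by (simp add: R_def)
  have R0: "R 0 = 1" and R1: "R (Suc 0) = [:-b, 1:]"
    and R2: "R (Suc (Suc 0)) = [:-b, 1:] * R (Suc 0) - [:A:]"
    using \<alpha>[of 0] by (simp_all add: R_def eval_nat_numeral \<beta>)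
  have R3: "R (Suc (Suc (Suc k))) = [:-b, 1:] * R (Suc (Suc k))
      - smult (A * of_nat (k + 2)) (R (Suc k))
      - smult (C * of_nat (k + 1) * of_nat (k + 2)) (R k)" for k
    using \<alpha>[of "k + 1"] \<gamma>[of k] by (simp add: R_def eval_nat_numeral \<beta>)
  have op: "third_order_operator [:a00:] [:- a11 * b, a11:] [:- 2 * a11 * A:] [:- 6 * a11 * C:] p =
      smult a00 p + smult a11 ([:-b, 1:] * pderiv p) - smult (a11 * A) (pderiv (pderiv p))
      - smult (a11 * C) (pderiv (pderiv (pderiv p)))" for p
    by (simp add: third_order_operator_def numeral_2_eq_2 numeral_3_eq_3 fact_numeral
        smult_add_right smult_diff_right)
  consider "n = 0" | "n = Suc 0" | "n = Suc (Suc 0)" | k where "n = Suc (Suc (Suc k))"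
    by (metis not0_implies_Suc)
  then have "smult a00 (R n) + smult a11 ([:-b, 1:] * pderiv (R n))
      - smult (a11 * A) (pderiv (pderiv (R n))) - smult (a11 * C) (pderiv (pderiv (pderiv (R n))))
      = smult (a00 + of_nat n * a11) (R n)"
  proof cases
    case 4
    show ?thesis
      unfolding 4 d pderiv_smult unfolding R3[of k] poly_eq_poly_eq_iff[symmetric]
      by (rule ext) (simp add: algebra_simps)
  qed (simp_all add: R0 R1 R2 pderiv_pCons algebra_simps)
  then show ?thesis unfolding op by (simp add: R_def)
qed

end

section \<open>Identification of the 2-orthogonal eigenpolynomials with the Appell sequence\<close>

theorem proposition4p1:
  fixes a00 a01 a11 a02 a12 a03 :: complex
    and J :: "complex poly \<Rightarrow> complex poly"
    and ev :: "nat \<Rightarrow> complex"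
  assumes "a11 \<noteq> 0" and "a03 \<noteq> 0"
    and J: "J = third_order_operator [:a00:] [:a01, a11:] [:a02, a12:] [:a03:]"
    and ev: "\<And>n. ev n = of_nat n * a11 + a00"
    and "\<And>n. ev n \<noteq> 0"
  shows "(\<forall>P. two_orthogonal P \<and> (\<forall>n. J (P n) = smult (ev n) (P n)) \<longrightarrow>
            a12 = 0 \<and>
            (\<forall>\<beta> \<alpha> \<gamma>. recurrence_coefficients P \<beta> \<alpha> \<gamma> \<longleftrightarrow>
              (\<forall>n. \<beta> n = - (a01 / a11) \<and>
                   \<alpha> (n + 1) = - (a02 / (2 * a11)) * of_nat (n + 1) \<and>
                   \<gamma> (n + 1) = - (a03 / a11) * (1 / 3 + 1 / 2 * of_nat n + 1 / 6 * (of_nat n)\<^sup>2) \<and>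
                   \<gamma> (n + 1) = - (a03 / (6 * a11)) * of_nat (n + 1) * of_nat (n + 2))))
       \<and> (a12 = 0 \<longrightarrow>
            (\<forall>\<beta> \<alpha> \<gamma>.
              (\<forall>n. \<beta> n = - (a01 / a11) \<and>
                   \<alpha> (n + 1) = - (a02 / (2 * a11)) * of_nat (n + 1) \<and>
                   \<gamma> (n + 1) = - (a03 / (6 * a11)) * of_nat (n + 1) * of_nat (n + 2)) \<longrightarrow>
              two_orthogonal (recurrence_polys \<beta> \<alpha> \<gamma>) \<and>
              (\<forall>n. J (recurrence_polys \<beta> \<alpha> \<gamma> n) = smult (ev n) (recurrence_polys \<beta> \<alpha> \<gamma> n))))"
proof -
  define std where "std \<beta> \<alpha> \<gamma> \<longleftrightarrow> (\<forall>n::nat. \<beta> n = - (a01 / a11) \<and>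
      \<alpha> (n + 1) = - (a02 / (2 * a11)) * of_nat (n + 1) \<and>
      \<gamma> (n + 1) = - (a03 / (6 * a11)) * of_nat (n + 1) * of_nat (n + 2))"
    for \<beta> \<alpha> \<gamma> :: "nat \<Rightarrow> complex"
  have ev': "ev n = a00 + of_nat n * a11" for n by (simp add: ev)
  interpret third_order a00 a01 a11 a02 a12 a03 J by unfold_locales (rule J)
  have std_nonzero: "\<gamma> (n + 1) \<noteq> 0" if "std \<beta> \<alpha> \<gamma>" for \<beta> \<alpha> \<gamma> n
  proof -
    have "of_nat (n + 1) \<noteq> (0 :: complex)" "of_nat (n + 2) \<noteq> (0 :: complex)"
      unfolding of_nat_eq_0_iff by simp_all
    then show ?thesis using that assms(1,2) unfolding std_def by simp
  qed
  have std_eigen: "J (recurrence_polys \<beta> \<alpha> \<gamma> n) = smult (ev n) (recurrence_polys \<beta> \<alpha> \<gamma> n)"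
    if "std \<beta> \<alpha> \<gamma>" "a12 = 0" for \<beta> \<alpha> \<gamma> n
    using eigen_recurrence_polys[of \<beta> "- (a01 / a11)" \<alpha> "- (a02 / (2 * a11))" \<gamma>
        "- (a03 / (6 * a11))" a00 a11 n] that assms(1)
    by (simp add: std_def J ev')
  have ii: "two_orthogonal (recurrence_polys \<beta> \<alpha> \<gamma>) \<and>
      (\<forall>n. J (recurrence_polys \<beta> \<alpha> \<gamma> n) = smult (ev n) (recurrence_polys \<beta> \<alpha> \<gamma> n))"
    if "std \<beta> \<alpha> \<gamma>" "a12 = 0" for \<beta> \<alpha> \<gamma>
    using that std_eigen two_orthogonal_recurrence_polys std_nonzero by blast
  have i: "a12 = 0 \<and> (\<forall>\<beta> \<alpha> \<gamma>. recurrence_coefficients P \<beta> \<alpha> \<gamma> \<longleftrightarrow> std \<beta> \<alpha> \<gamma>)"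
    if P: "two_orthogonal P" "\<forall>n. J (P n) = smult (ev n) (P n)" for P
  proof -
    obtain u where "two_orthogonal_basis P u" using two_orthogonal_basis_obtain[OF P(1)] .
    then interpret two_orthogonal_basis P u .
    interpret two_orthogonal_eigenbasis a00 a01 a11 a02 a12 a03 J P u
      by unfold_locales (use assms P ev' in auto)
    \<comment> \<open>Both sides are monic eigenpolynomials for the same eigenvalue, so the
      coefficients of \<open>P\<close> need not be computed.\<close>
    have P_eq: "P = recurrence_polys \<beta> \<alpha> \<gamma>" if "std \<beta> \<alpha> \<gamma>" for \<beta> \<alpha> \<gamma>
    proof
      fix n
      show "P n = recurrence_polys \<beta> \<alpha> \<gamma> n"
        using eigenpolynomial_unique[OF assms(1), of "P n" n "recurrence_polys \<beta> \<alpha> \<gamma> n"]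
          std_eigen[OF that a12_eq_0, of n] P(2) monic_recurrence_polys[of \<beta> \<alpha> \<gamma>]
          recurrence_polys_degree_lead[of n \<beta> \<alpha> \<gamma>]
        by (simp add: ev' monic_polynomial_sequence_def)
    qed
    have "recurrence_coefficients P \<beta> \<alpha> \<gamma> \<longleftrightarrow> std \<beta> \<alpha> \<gamma>" for \<beta> \<alpha> \<gamma>
    proof
      assume "std \<beta> \<alpha> \<gamma>"
      moreover have "\<gamma> n \<noteq> 0" if "n \<ge> 1" for n
        using std_nonzero[OF \<open>std \<beta> \<alpha> \<gamma>\<close>, of "n - 1"] that by simp
      ultimately show "recurrence_coefficients P \<beta> \<alpha> \<gamma>"
        using P_eq unfolding recurrence_coefficients_def by blast
    next
      assume "recurrence_coefficients P \<beta> \<alpha> \<gamma>"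
      then have eq: "P = recurrence_polys \<beta> \<alpha> \<gamma>" by (auto simp: recurrence_coefficients_def)
      \<comment> \<open>The predicate \<open>std\<close> leaves \<open>\<alpha> 0\<close> and
        \<open>\<gamma> 0\<close> free; extending the formulas to index 0 gives concrete sequences
        to compare with.\<close>
      define \<beta>' \<alpha>' \<gamma>' :: "nat \<Rightarrow> complex"
        where "\<beta>' n = - (a01 / a11)"
          and "\<alpha>' n = - (a02 / (2 * a11)) * of_nat n"
          and "\<gamma>' n = - (a03 / (6 * a11)) * of_nat n * of_nat (n + 1)" for n
      have "std \<beta>' \<alpha>' \<gamma>'" by (simp add: std_def \<beta>'_def \<alpha>'_def \<gamma>'_def)
      then have "recurrence_polys \<beta> \<alpha> \<gamma> = recurrence_polys \<beta>' \<alpha>' \<gamma>'"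
        using eq P_eq by metis
      from recurrence_polys_inject[OF this] \<open>std \<beta>' \<alpha>' \<gamma>'\<close> show "std \<beta> \<alpha> \<gamma>"
        by (simp add: std_def)
    qed
    then show ?thesis using a12_eq_0 by blast
  qed
  \<comment> \<open>Since \<open>1/3 + n/2 + n^2/6 = (n + 1) * (n + 2) / 6\<close>, the two
    conditions on \<open>\<gamma> (n + 1)\<close> coincide.\<close>
  have "- (a03 / a11) * (1 / 3 + 1 / 2 * of_nat n + 1 / 6 * (of_nat n)\<^sup>2) =
      - (a03 / (6 * a11)) * of_nat (n + 1) * of_nat (n + 2)" for n :: nat
    using assms(1) by (simp add: field_simps power2_eq_square)
  then have "(\<forall>n. \<beta> n = - (a01 / a11) \<and>
         \<alpha> (n + 1) = - (a02 / (2 * a11)) * of_nat (n + 1) \<and>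
         \<gamma> (n + 1) = - (a03 / a11) * (1 / 3 + 1 / 2 * of_nat n + 1 / 6 * (of_nat n)\<^sup>2) \<and>
         \<gamma> (n + 1) = - (a03 / (6 * a11)) * of_nat (n + 1) * of_nat (n + 2)) \<longleftrightarrow> std \<beta> \<alpha> \<gamma>"
    for \<beta> \<alpha> \<gamma> by (simp only: std_def conj_absorb)
  then show ?thesis unfolding std_def[symmetric] using i ii by blast
qed

end
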